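(* Let $n$, $l$ and $\mu$ be integers with $l \geq 1$ and $1 \leq \mu \leq n-l$, and for each integer $m\ge 1$ and real $\nu\in[0,m]$ let $X_{m,\nu} \sim \mathrm{Bin}(m, \nu/m)$. Then $$\frac12 \;\geq\; \mathbb{P}(X_{n,\mu} \geq \mu+l) \;\geq\; \mathbb{P}(X_{\mu+l,\mu} = \mu+l) = \left( \frac{\mu}{\mu+l} \right)^{\mu+l} \;\geq\; \mathbb{P}(X_{1+l,1} = 1+l) = \frac{1}{(1+l)^{1+l}}.$$
   Context: $\mathrm{Bin}(m,q)$ denotes the binomial distribution with $m$ trials and success probability $q$; thus $X_{m,\nu}$ is a binomial random variable with $m$ trials and expected value $\nu$. *)

theory Defs
  imports "HOL-Probability.Probability"
begin

end

theory Submission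
  imports Defs
begin

text \<open>
  Write \<open>T\<^sub>n(c, p)\<close> for the probability that \<open>n\<close> independent trials with success
  probability \<open>p\<close> give at least \<open>c\<close> successes. Everything follows from the behaviour of
  \<open>T\<^sub>n(c, \<mu>/n)\<close> when the mean \<open>\<mu>\<close> is held fixed and the number of trials grows.

  This tail is nondecreasing in \<open>n\<close> as soon as \<open>c \<ge> \<mu> + 1\<close>
  (\<open>binomial_tail_trials_mono\<close>), an instance of Hoeffding's principle that, for a given
  mean, upper tails beyond the mean are largest when the success probabilities are equal.
  The step from \<open>m\<close> to \<open>m + 1\<close> trials moves continuously from \<open>m\<close> equal trials and
  an impossible one to \<open>m + 1\<close> equal trials, keeping the total mean; the sign of the
  derivative is the comparison of two neighbouring binomial weights above the mode.
  Starting from \<open>n = \<mu> + l\<close>, where the tail is the single point mass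
  \<open>(\<mu>/(\<mu>+l))\<^bsup>\<mu>+l\<^esup>\<close>, this gives the lower bound.

  For the upper bound by one half it suffices to treat \<open>c = \<mu> + 1\<close>. The same
  monotonicity allows \<open>n\<close> to be increased until \<open>2\<mu> \<le> n\<close>, that is, until
  \<open>p = \<mu>/n \<le> 1/2\<close>. Then \<open>T\<^sub>n(c, p)\<close> grows faster to the right of \<open>p\<close> than at
  the mirror image on the left (\<open>reflected_power_product_le\<close>), so
  \<open>2 T\<^sub>n(c, p) \<le> T\<^sub>n(c, 2p) + T\<^sub>n(c, 0) \<le> 1\<close>.

  The last inequality says that \<open>(x/(x+l))\<^bsup>x+l\<^esup>\<close> increases with \<open>x\<close>, by
  \<open>ln y \<le> y - 1\<close> applied to the derivative of its logarithm (\<open>ratio_power_mono\<close>).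
\<close>

section \<open>Upper tails of binomial distributions as Bernstein sums\<close>

definition binomial_tail :: "nat \<Rightarrow> nat \<Rightarrow> real \<Rightarrow> real" where
  "binomial_tail n c p = (\<Sum>j=c..n. Bernstein n j p)"

text \<open>Conditioning on the outcome of one trial.\<close>

lemma Bernstein_Suc:
  "Bernstein (Suc n) (Suc j) p = p * Bernstein n j p + (1 - p) * Bernstein n (Suc j) p"
proof (cases "Suc j \<le> n")
  case True
  then have "n - j = Suc (n - Suc j)" by simp
  then show ?thesis by (simp add: Bernstein_def algebra_simps)
next
  case False
  then have "n = j \<or> n < j" by auto
  then show ?thesis by (auto simp: Bernstein_def binomial_eq_0)
qed

lemma binomial_tail_rec:
  "binomial_tail n c p = Bernstein n c p + binomial_tail n (Suc c) p"
proof (cases "c \<le> n")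
  case True
  then show ?thesis by (simp add: binomial_tail_def sum.atLeast_Suc_atMost)
next
  case False
  then show ?thesis by (simp add: binomial_tail_def Bernstein_def)
qed

text \<open>
  The first \<open>n\<close> trials already reach \<open>c + 1\<close> successes, or they stop exactly one short
  and the last trial succeeds.
\<close>

lemma binomial_tail_Suc:
  "binomial_tail (Suc n) (Suc c) p = binomial_tail n (Suc c) p + p * Bernstein n c p"
proof -
  have top: "Bernstein n (Suc n) p = 0"
    by (simp add: Bernstein_def)
  have "binomial_tail (Suc n) (Suc c) p = (\<Sum>j=c..n. Bernstein (Suc n) (Suc j) p)"
    unfolding binomial_tail_def by (rule sum.shift_bounds_cl_Suc_ivl)
  also have "\<dots> = p * binomial_tail n c p + (1 - p) * (\<Sum>j=c..n. Bernstein n (Suc j) p)"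
    by (simp add: Bernstein_Suc binomial_tail_def sum.distrib sum_distrib_left)
  also have "(\<Sum>j=c..n. Bernstein n (Suc j) p) = (\<Sum>j=Suc c..Suc n. Bernstein n j p)"
    by (rule sum.shift_bounds_cl_Suc_ivl [symmetric])
  also have "\<dots> = binomial_tail n (Suc c) p"
    by (simp add: binomial_tail_def top)
  finally show ?thesis
    by (simp add: binomial_tail_rec [of n c] algebra_simps)
qed

lemma binomial_tail_at_0: "binomial_tail n (Suc c) 0 = 0"
  by (simp add: binomial_tail_def Bernstein_def)

lemma binomial_tail_le_1:
  assumes "0 \<le> p" "p \<le> 1"
  shows "binomial_tail n c p \<le> 1"
proof -
  have "binomial_tail n c p \<le> (\<Sum>j\<le>n. Bernstein n j p)"
    unfolding binomial_tail_def using assms by (intro sum_mono2) (auto simp: Bernstein_nonneg)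
  then show ?thesis by simp
qed

text \<open>
  Both terms come from the product rule, with the factors \<open>j + 1\<close> and \<open>n - j\<close> absorbed
  into the binomial coefficient. The difference on the right is what makes the derivative
  of a tail telescope to a single term.
\<close>

lemma DERIV_Bernstein:
  "((\<lambda>p. Bernstein (Suc n) (Suc j) p) has_real_derivative
     real (Suc n) * (Bernstein n j p - Bernstein n (Suc j) p)) (at p within S)"
proof (cases "Suc j \<le> n")
  case True
  then obtain d where n: "n = Suc (j + d)"
    by (metis add_Suc le_iff_add)
  have absorb1: "real (Suc n choose Suc j) * real (Suc j) = real (Suc n) * real (n choose j)"
    by (metis Suc_times_binomial_eq mult.commute of_nat_mult)
  have "Suc n * (n choose Suc j) = (Suc n choose Suc j) * (n - j)"
    using binomial_absorb_comp [of "Suc n" "Suc j"] by (simp add: mult.commute)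
  then have absorb2: "real (Suc n choose Suc j) * real (n - j) = real (Suc n) * real (n choose Suc j)"
    by (metis of_nat_mult)
  define A where "A = real (Suc n choose Suc j)"
  have "((\<lambda>p. A * p ^ Suc j * (1 - p) ^ Suc d) has_real_derivative
      A * real (Suc j) * (p ^ j * (1 - p) ^ Suc d) - A * real (Suc d) * (p ^ Suc j * (1 - p) ^ d))
      (at p within S)"
    by (rule derivative_eq_intros refl)+ simp
  moreover have "A * real (Suc j) = real (Suc n) * real (n choose j)"
    "A * real (Suc d) = real (Suc n) * real (n choose Suc j)"
    using absorb1 absorb2 n by (simp_all add: A_def)
  moreover have "Bernstein (Suc n) (Suc j) = (\<lambda>p. A * p ^ Suc j * (1 - p) ^ Suc d)"
    by (rule ext) (simp add: Bernstein_def A_def n)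
  moreover have "Bernstein n j p = real (n choose j) * (p ^ j * (1 - p) ^ Suc d)"
    "Bernstein n (Suc j) p = real (n choose Suc j) * (p ^ Suc j * (1 - p) ^ d)"
    by (simp_all add: Bernstein_def n)
  ultimately show ?thesis
    by (simp only: right_diff_distrib mult.assoc)
next
  case False
  then consider "n = j" | "n < j" by linarith
  then show ?thesis
  proof cases
    case 1
    have "((\<lambda>p. p ^ Suc n) has_real_derivative real (Suc n) * p ^ n) (at p within S)"
      by (rule derivative_eq_intros refl)+ simp
    with 1 show ?thesis
      by (simp add: Bernstein_def binomial_eq_0)
  next
    case 2
    then show ?thesis
      by (simp add: Bernstein_def binomial_eq_0)
  qed
qed

lemma DERIV_binomial_tail:
  "((\<lambda>p. binomial_tail (Suc n) (Suc c) p) has_real_derivative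
     real (Suc n) * Bernstein n c p) (at p within S)"
proof -
  have "((\<lambda>p. \<Sum>j=Suc c..Suc n. Bernstein (Suc n) j p) has_real_derivative
          (\<Sum>j=c..n. real (Suc n) * (Bernstein n j p - Bernstein n (Suc j) p))) (at p within S)"
    unfolding sum.shift_bounds_cl_Suc_ivl by (intro DERIV_sum DERIV_Bernstein)
  moreover have "(\<Sum>j=c..n. Bernstein n j p - Bernstein n (Suc j) p) = Bernstein n c p"
  proof (cases "c \<le> n")
    case True
    moreover have "Bernstein n (Suc n) p = 0" by (simp add: Bernstein_def)
    ultimately show ?thesis
      using sum_Suc_diff [of c n "\<lambda>j. - Bernstein n j p"] by simp
  next
    case False
    then show ?thesis by (simp add: Bernstein_def)
  qed
  ultimately show ?thesis
    by (simp add: binomial_tail_def flip: sum_distrib_left)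
qed

section \<open>Monotonicity in the number of trials\<close>

text \<open>
  The quotient of the two weights is \<open>(k - j) p / ((j + 1) (1 - p))\<close>, which is at most
  \<open>1\<close> exactly when \<open>(k + 1) p \<le> j + 1\<close>.
\<close>

lemma Bernstein_decreasing_above_mode:
  assumes "0 \<le> p" "p < 1" "real (Suc k) * p \<le> real (Suc j)"
  shows "Bernstein k (Suc j) p \<le> Bernstein k j p"
proof (cases "Suc j \<le> k")
  case True
  have absorb: "real (k choose Suc j) * real (Suc j) = real (k choose j) * real (k - j)"
    by (metis binomial_absorb_comp binomial_absorption mult.commute of_nat_mult)
  have kj: "k - j = Suc (k - Suc j)" using True by simp
  have "real (k - j) * p \<le> real (Suc j) * (1 - p)"
    using assms True by (simp add: of_nat_diff algebra_simps)
  then have "real (k choose j) * (real (k - j) * p) \<le> real (k choose j) * (real (Suc j) * (1 - p))"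
    by (intro mult_left_mono) auto
  then have "real (Suc j) * (real (k choose Suc j) * p)
      \<le> real (Suc j) * (real (k choose j) * (1 - p))"
    using absorb by (simp add: algebra_simps)
  then have "real (k choose Suc j) * p \<le> real (k choose j) * (1 - p)"
    by (subst (asm) mult_le_cancel_left_pos) auto
  then have "(real (k choose Suc j) * p) * (p ^ j * (1 - p) ^ (k - Suc j))
      \<le> (real (k choose j) * (1 - p)) * (p ^ j * (1 - p) ^ (k - Suc j))"
    using assms by (intro mult_right_mono) auto
  then show ?thesis
    by (simp add: Bernstein_def kj algebra_simps)
next
  case False
  then show ?thesis using assms
    by (simp add: Bernstein_def binomial_eq_0)
qed

text \<open>
  Interpolate through \<open>m\<close> trials with success probability \<open>p\<close> and one further trial with
  probability \<open>\<mu> - m p\<close>: the total mean stays \<open>\<mu>\<close>. At \<open>p = \<mu>/m\<close> the extra trial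
  never succeeds, and at \<open>p = \<mu>/(m+1)\<close> it is like all the others. In between,
  \<open>G p\<close> is the probability of at least \<open>c + 2\<close> successes, and it does not increase
  with \<open>p\<close>. The threshold has the form \<open>c + 2\<close> because the derivative involves weights
  at one and at two places below it.
\<close>

lemma binomial_tail_Suc_trials_mono:
  fixes m c :: nat and \<mu> :: real
  assumes "0 \<le> \<mu>" "\<mu> < real m" "\<mu> \<le> real (Suc c)"
  shows "binomial_tail m (Suc (Suc c)) (\<mu> / real m)
         \<le> binomial_tail (Suc m) (Suc (Suc c)) (\<mu> / real (Suc m))"
proof -
  obtain k where m: "m = Suc k" using assms by (cases m) auto
  define a where "a = \<mu> / real (Suc m)"
  define b where "b = \<mu> / real m"
  define G where "G p = binomial_tail m (Suc (Suc c)) p + (\<mu> - real m * p) * Bernstein m (Suc c) p" for p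
  have ab: "0 \<le> a" "a \<le> b" "b < 1" "real m * b = \<mu>" "real (Suc m) * a = \<mu>"
    using assms m by (auto simp: a_def b_def field_simps)
  have "G b \<le> G a"
  proof (rule DERIV_nonpos_imp_nonincreasing [OF \<open>a \<le> b\<close>])
    fix p assume p: "a \<le> p" "p \<le> b"
    have 1: "real (Suc m) * a \<le> real (Suc m) * p" "real m * p \<le> real m * b"
      using p by (auto intro!: mult_left_mono)
    have "(G has_real_derivative
        real m * Bernstein k (Suc c) p
        + ((- real m) * Bernstein m (Suc c) p
           + (\<mu> - real m * p) * (real m * (Bernstein k c p - Bernstein k (Suc c) p)))) (at p)"
      unfolding G_def m
      by (rule derivative_eq_intros DERIV_binomial_tail DERIV_Bernstein refl)+
        (simp add: algebra_simps)
    \<comment> \<open>Splitting off one of the \<open>m\<close> trials factors the derivative: the excess of \<open>p\<close> over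
       the extra probability times the difference of two neighbouring weights.\<close>
    then have "(G has_real_derivative
        real m * (p - (\<mu> - real m * p)) * (Bernstein k (Suc c) p - Bernstein k c p)) (at p)"
      by (rule back_subst [of "\<lambda>D. (G has_real_derivative D) (at p)"])
        (simp add: m Bernstein_Suc algebra_simps)
    moreover have "Bernstein k (Suc c) p \<le> Bernstein k c p"
      using ab p 1 assms by (intro Bernstein_decreasing_above_mode) (auto simp: m)
    moreover have "0 \<le> p - (\<mu> - real m * p)"
      using 1 ab by (simp add: algebra_simps)
    ultimately show "\<exists>y. (G has_real_derivative y) (at p) \<and> y \<le> 0"
      by (meson diff_le_0_iff_le mult_nonneg_nonpos mult_nonneg_nonneg of_nat_0_le_iff)
  qed
  moreover have "G b = binomial_tail m (Suc (Suc c)) b"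
    by (simp add: G_def ab)
  moreover have "\<mu> - real m * a = a"
    using ab(5) by (simp add: algebra_simps)
  then have "G a = binomial_tail (Suc m) (Suc (Suc c)) a"
    by (simp add: G_def binomial_tail_Suc)
  ultimately show ?thesis by (simp add: a_def b_def)
qed

lemma binomial_tail_trials_mono:
  fixes c m n :: nat and \<mu> :: real
  assumes "m \<le> n" "0 \<le> \<mu>" "\<mu> < real m" "\<mu> \<le> real (Suc c)"
  shows "binomial_tail m (Suc (Suc c)) (\<mu> / real m)
         \<le> binomial_tail n (Suc (Suc c)) (\<mu> / real n)"
  using assms(1)
proof (induction n rule: dec_induct)
  case (step i)
  then show ?case
    using binomial_tail_Suc_trials_mono [of \<mu> i c] assms by simp
qed simp

section \<open>At most half of the mass lies above the mean\<close>

text \<open>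
  The density of the tail is proportional to \<open>t\<^sup>k (1 - t)\<^sup>m\<close>; this compares it at \<open>p + s\<close>
  and \<open>p - s\<close> when \<open>q = 1 - p\<close>. The logarithm \<open>D s\<close> of the quotient vanishes at \<open>0\<close>,
  and its derivative is \<open>2 k p / (p\<^sup>2 - s\<^sup>2) - 2 m q / (q\<^sup>2 - s\<^sup>2)\<close>. For \<open>p \<le> q\<close> the
  first term dominates, since \<open>k / p = (m + 1) / q\<close> and \<open>s/p \<ge> s/q\<close>.
\<close>

lemma reflected_power_product_le:
  fixes p s :: real and k m :: nat
  assumes s: "0 \<le> s" "s < p" and pq: "p \<le> q" and k: "real k * q = real (Suc m) * p"
  shows "(p - s) ^ k * (q + s) ^ m \<le> (p + s) ^ k * (q - s) ^ m"
proof -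
  define D where "D t = real k * (ln (p + t) - ln (p - t)) + real m * (ln (q - t) - ln (q + t))" for t
  have "D 0 \<le> D s"
  proof (rule DERIV_nonneg_imp_nondecreasing [OF s(1)])
    fix t assume t: "0 \<le> t" "t \<le> s"
    have pos: "0 < p - t" "0 < p + t" "0 < q - t" "0 < q + t" "0 < p" "0 < q"
      using s pq t by auto
    have "(D has_real_derivative
       real k * (1 / (p + t) + 1 / (p - t)) - real m * (1 / (q - t) + 1 / (q + t))) (at t)"
      unfolding D_def using pos
      by (auto intro!: derivative_eq_intros simp: divide_simps)
    moreover have "real m * (1 / (q - t) + 1 / (q + t)) \<le> real k * (1 / (p + t) + 1 / (p - t))"
    proof -
      have sq: "t\<^sup>2 < p\<^sup>2" "p\<^sup>2 \<le> q\<^sup>2"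
        using t s pq by (auto intro!: power_strict_mono power_mono)
      have "q * (real m * q * (p\<^sup>2 - t\<^sup>2)) = real m * (q\<^sup>2 * p\<^sup>2 - q\<^sup>2 * t\<^sup>2)"
        by (simp add: algebra_simps power2_eq_square)
      also have "\<dots> \<le> real m * (q\<^sup>2 * p\<^sup>2 - p\<^sup>2 * t\<^sup>2)"
        using sq by (intro mult_left_mono diff_left_mono mult_right_mono) auto
      also have "\<dots> = real m * (p\<^sup>2 * (q\<^sup>2 - t\<^sup>2))"
        by (simp add: algebra_simps)
      also have "\<dots> \<le> real (Suc m) * (p\<^sup>2 * (q\<^sup>2 - t\<^sup>2))"
        using sq by (intro mult_right_mono) auto
      also have "\<dots> = real k * q * p * (q\<^sup>2 - t\<^sup>2)"
        unfolding k by (simp add: power2_eq_square)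
      also have "\<dots> = q * (real k * p * (q\<^sup>2 - t\<^sup>2))"
        by (simp add: mult_ac)
      finally have key: "real m * q * (p\<^sup>2 - t\<^sup>2) \<le> real k * p * (q\<^sup>2 - t\<^sup>2)"
        using pos by (simp add: mult_le_cancel_left_pos)
      have recip: "1 / (r - t) + 1 / (r + t) = 2 * r / (r\<^sup>2 - t\<^sup>2)"
        if "0 < r - t" "0 < r + t" for r
      proof -
        have "r\<^sup>2 - t\<^sup>2 = (r - t) * (r + t)"
          by (simp add: power2_eq_square algebra_simps)
        then show ?thesis
          using that by (simp add: add_frac_eq)
      qed
      have "real m * (1 / (q - t) + 1 / (q + t)) = 2 * (real m * q / (q\<^sup>2 - t\<^sup>2))"
        using recip [of q] pos by simp
      also have "\<dots> \<le> 2 * (real k * p / (p\<^sup>2 - t\<^sup>2))"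
        using key sq by (simp add: divide_simps)
      also have "\<dots> = real k * (1 / (p + t) + 1 / (p - t))"
        using recip [of p] pos by (simp add: add.commute)
      finally show ?thesis .
    qed
    ultimately show "\<exists>y. (D has_real_derivative y) (at t) \<and> 0 \<le> y"
      by force
  qed
  then have D: "0 \<le> D s" by (simp add: D_def)
  have pos: "0 < p - s" "0 < p + s" "0 < q - s" "0 < q + s"
    using s pq by auto
  have "ln ((p - s) ^ k * (q + s) ^ m) \<le> ln ((p + s) ^ k * (q - s) ^ m)"
    using D pos by (simp add: D_def ln_mult_pos ln_realpow algebra_simps)
  then show ?thesis
    using pos by (subst (asm) ln_le_cancel_iff) auto
qed

text \<open>
  \<open>H s\<close> symmetrises the tail about \<open>p\<close>. It does not decrease while \<open>p - s\<close> runs down to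
  \<open>0\<close>, where one summand is \<open>0\<close> and the other at most \<open>1\<close>. The point \<open>2p\<close> is still a
  probability because \<open>2k \<le> n\<close>.
\<close>

lemma binomial_tail_above_mean_le_half_small_mean:
  assumes k: "1 \<le> k" "2 * k \<le> n"
  shows "binomial_tail n (Suc k) (real k / real n) \<le> 1 / 2"
proof -
  obtain N where n: "n = Suc N" using k by (cases n) auto
  define m where "m = N - k"
  have m: "n = Suc m + k" using k n by (simp add: m_def)
  define p where "p = real k / real n"
  define q where "q = 1 - p"
  have "q = real (Suc m) / real n"
    using m by (simp add: p_def q_def field_simps)
  then have p: "0 < p" "p \<le> q" "real k * q = real (Suc m) * p"
    using k m by (simp_all add: p_def divide_right_mono)
  define H where "H s = binomial_tail n (Suc k) (p + s) + binomial_tail n (Suc k) (p - s)" for s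
  have deriv: "(H has_real_derivative
      real n * (Bernstein N k (p + s) - Bernstein N k (p - s))) (at s)" for s
  proof -
    have "((\<lambda>s. binomial_tail n (Suc k) (p + s)) has_real_derivative
        real n * Bernstein N k (p + s) * 1) (at s)"
      unfolding n by (rule DERIV_chain2 [OF DERIV_binomial_tail]) (auto intro!: derivative_eq_intros)
    moreover have "((\<lambda>s. binomial_tail n (Suc k) (p - s)) has_real_derivative
        real n * Bernstein N k (p - s) * (-1)) (at s)"
      unfolding n by (rule DERIV_chain2 [OF DERIV_binomial_tail]) (auto intro!: derivative_eq_intros)
    ultimately show ?thesis
      unfolding H_def by (auto intro!: derivative_eq_intros simp: algebra_simps)
  qed
  have "H 0 \<le> H p"
  proof (rule DERIV_nonneg_imp_increasing_open [where f = H])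
    show "0 \<le> p" using p by simp
  next
    fix s assume s: "0 < s" "s < p"
    have "(p - s) ^ k * (1 - (p - s)) ^ m \<le> (p + s) ^ k * (1 - (p + s)) ^ m"
      using reflected_power_product_le [of s p q k m] s p by (simp add: q_def algebra_simps)
    then have "Bernstein N k (p - s) \<le> Bernstein N k (p + s)"
      by (simp add: Bernstein_def m_def mult.assoc mult_left_mono)
    then show "\<exists>y. (H has_real_derivative y) (at s) \<and> 0 \<le> y"
      using deriv by force
  next
    show "continuous_on {0..p} H"
      using deriv by (meson DERIV_isCont continuous_at_imp_continuous_on)
  qed
  moreover have "H 0 = 2 * binomial_tail n (Suc k) p"
    by (simp add: H_def)
  moreover have "H p \<le> 1"
    using p binomial_tail_le_1 [of "p + p"] by (simp add: H_def binomial_tail_at_0 q_def)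
  ultimately show ?thesis by (simp add: p_def)
qed

text \<open>
  More trials with the same mean only enlarge the tail, so the mean may be assumed to be at
  most half the number of trials.
\<close>

lemma binomial_tail_above_mean_le_half:
  assumes k: "1 \<le> k" "k < n"
  shows "binomial_tail n (Suc k) (real k / real n) \<le> 1 / 2"
proof -
  obtain c where c: "k = Suc c" using k by (cases k) auto
  have "binomial_tail n (Suc k) (real k / real n)
      \<le> binomial_tail (max n (2 * k)) (Suc k) (real k / real (max n (2 * k)))"
    unfolding c using k c by (intro binomial_tail_trials_mono) auto
  also have "\<dots> \<le> 1 / 2"
    using k by (intro binomial_tail_above_mean_le_half_small_mean) auto
  finally show ?thesis .
qed

section \<open>The extreme point as a function of the mean\<close>

text \<open>
  The logarithm \<open>g\<close> has derivative \<open>y - 1 - ln y\<close> with \<open>y = (x + l)/x\<close>.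
\<close>

lemma ratio_power_mono:
  fixes a b l :: nat
  assumes "1 \<le> a" "a \<le> b"
  shows "(real a / real (a + l)) ^ (a + l) \<le> (real b / real (b + l)) ^ (b + l)"
proof -
  define g where "g x = (x + real l) * (ln x - ln (x + real l))" for x
  have g: "(real x / real (x + l)) ^ (x + l) = exp (g (real x))" if "1 \<le> x" for x
  proof -
    have "ln ((real x / real (x + l)) ^ (x + l)) = g (real x)"
      using that by (simp add: g_def ln_realpow ln_div)
    then show ?thesis
      using that by (metis exp_ln divide_pos_pos of_nat_0_less_iff zero_less_power
          less_le_trans zero_less_one trans_less_add1)
  qed
  have "g (real a) \<le> g (real b)"
  proof (rule DERIV_nonneg_imp_nondecreasing [where f = g])
    show "real a \<le> real b" using assms by simp
  next
    fix x assume x: "real a \<le> x" "x \<le> real b"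
    then have pos: "0 < x" "0 < x + real l" using assms by auto
    have "(g has_real_derivative
        ln x - ln (x + real l) + (x + real l) * (1 / x - 1 / (x + real l))) (at x)"
      unfolding g_def using pos by (auto intro!: derivative_eq_intros)
    moreover have "ln x - ln (x + real l) + (x + real l) * (1 / x - 1 / (x + real l))
        = (x + real l) / x - 1 - ln ((x + real l) / x)"
      using pos by (simp add: ln_div right_diff_distrib)
    ultimately have "(g has_real_derivative (x + real l) / x - 1 - ln ((x + real l) / x)) (at x)"
      by simp
    moreover have "ln ((x + real l) / x) \<le> (x + real l) / x - 1"
      using pos by (intro ln_le_minus_one) simp
    ultimately show "\<exists>y. (g has_real_derivative y) (at x) \<and> 0 \<le> y"
      by force
  qed
  then show ?thesis using assms by (simp only: g) simp
qed

section \<open>The chain of tail bounds\<close>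

lemma prob_binomial_pmf_eq_binomial_tail:
  assumes "0 \<le> p" "p \<le> 1"
  shows "measure_pmf.prob (binomial_pmf n p) {c..} = binomial_tail n c p"
proof -
  have "measure_pmf.prob (binomial_pmf n p) {c..} = measure_pmf.prob (binomial_pmf n p) {c..n}"
    using assms by (intro measure_pmf.finite_measure_eq_AE)
      (auto simp: AE_measure_pmf_iff pmf_eq_0_set_pmf set_pmf_binomial_eq split: if_splits)
  also have "\<dots> = binomial_tail n c p"
    unfolding binomial_tail_def using assms
    by (subst measure_measure_pmf_finite) (auto simp: Bernstein_def)
  finally show ?thesis .
qed

theorem theorem1:
  fixes n l \<mu> :: nat
    and M :: "nat \<Rightarrow> real \<Rightarrow> 'a measure"
    and X :: "nat \<Rightarrow> real \<Rightarrow> 'a \<Rightarrow> nat"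
  assumes prob_space: "\<And>m \<nu>. m \<ge> 1 \<Longrightarrow> \<nu> \<in> {0..real m} \<Longrightarrow> prob_space (M m \<nu>)"
    and measurable: "\<And>m \<nu>. m \<ge> 1 \<Longrightarrow> \<nu> \<in> {0..real m} \<Longrightarrow>
      X m \<nu> \<in> measurable (M m \<nu>) (count_space UNIV)"
    and binomial: "\<And>m \<nu>. m \<ge> 1 \<Longrightarrow> \<nu> \<in> {0..real m} \<Longrightarrow>
      distr (M m \<nu>) (count_space UNIV) (X m \<nu>) = measure_pmf (binomial_pmf m (\<nu> / real m))"
    and l: "l \<ge> 1"
    and \<mu>: "1 \<le> \<mu>" "\<mu> + l \<le> n"
  shows "1 / 2 \<ge> \<P>(\<omega> in M n (real \<mu>). X n (real \<mu>) \<omega> \<ge> \<mu> + l) \<and>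
      \<P>(\<omega> in M n (real \<mu>). X n (real \<mu>) \<omega> \<ge> \<mu> + l)
      \<ge> \<P>(\<omega> in M (\<mu> + l) (real \<mu>). X (\<mu> + l) (real \<mu>) \<omega> = \<mu> + l) \<and>
      \<P>(\<omega> in M (\<mu> + l) (real \<mu>). X (\<mu> + l) (real \<mu>) \<omega> = \<mu> + l)
      = (real \<mu> / real (\<mu> + l)) ^ (\<mu> + l) \<and>
      (real \<mu> / real (\<mu> + l)) ^ (\<mu> + l)
      \<ge> \<P>(\<omega> in M (1 + l) 1. X (1 + l) 1 \<omega> = 1 + l) \<and>
      \<P>(\<omega> in M (1 + l) 1. X (1 + l) 1 \<omega> = 1 + l) = 1 / real (1 + l) ^ (1 + l)"
proof -
  have law: "\<P>(\<omega> in M m \<nu>. P (X m \<nu> \<omega>)) = measure_pmf.prob (binomial_pmf m (\<nu> / real m)) {x. P x}"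
    if "m \<ge> 1" "\<nu> \<in> {0..real m}" for m \<nu> P
  proof -
    have "measure (distr (M m \<nu>) (count_space UNIV) (X m \<nu>)) {x. P x}
        = measure (M m \<nu>) (X m \<nu> -` {x. P x} \<inter> space (M m \<nu>))"
      using measurable [OF that] by (intro measure_distr) auto
    also have "X m \<nu> -` {x. P x} \<inter> space (M m \<nu>) = {\<omega> \<in> space (M m \<nu>). P (X m \<nu> \<omega>)}"
      by auto
    finally show ?thesis
      by (simp add: binomial [OF that])
  qed
  have tail: "\<P>(\<omega> in M m (real \<nu>). X m (real \<nu>) \<omega> \<ge> c) = binomial_tail m c (real \<nu> / real m)"
    if "1 \<le> m" "\<nu> \<le> m" for m \<nu> c :: nat
    using that law [of m "real \<nu>" "\<lambda>x. c \<le> x"] prob_binomial_pmf_eq_binomial_tail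
    by (simp add: atLeast_def)
  have top: "\<P>(\<omega> in M m (real \<nu>). X m (real \<nu>) \<omega> = m) = (real \<nu> / real m) ^ m"
    if "1 \<le> m" "\<nu> \<le> m" for m \<nu> :: nat
    using that law [of m "real \<nu>" "\<lambda>x. x = m"] by (simp add: measure_pmf_single)
  obtain c where c: "\<mu> + l = Suc (Suc c)"
    using l \<mu> by (metis One_nat_def Suc_le_D add_Suc add_Suc_right)
  have "binomial_tail n (\<mu> + l) (real \<mu> / real n) \<le> binomial_tail n (Suc \<mu>) (real \<mu> / real n)"
    unfolding binomial_tail_def using l \<mu>
    by (intro sum_mono2) (auto intro!: Bernstein_nonneg)
  also have "\<dots> \<le> 1 / 2"
    using l \<mu> by (intro binomial_tail_above_mean_le_half) auto
  finally have upper: "binomial_tail n (\<mu> + l) (real \<mu> / real n) \<le> 1 / 2" .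
  have "binomial_tail (\<mu> + l) (\<mu> + l) (real \<mu> / real (\<mu> + l))
      \<le> binomial_tail n (\<mu> + l) (real \<mu> / real n)"
    unfolding c using l \<mu> c by (intro binomial_tail_trials_mono) auto
  then have lower: "(real \<mu> / real (\<mu> + l)) ^ (\<mu> + l) \<le> binomial_tail n (\<mu> + l) (real \<mu> / real n)"
    by (simp add: binomial_tail_def Bernstein_def)
  have top1: "\<P>(\<omega> in M (1 + l) 1. X (1 + l) 1 \<omega> = 1 + l) = (real 1 / real (1 + l)) ^ (1 + l)"
    using top [of "1 + l" 1] by simp
  show ?thesis
    unfolding top1 using upper lower tail [of n \<mu>] top [of "\<mu> + l" \<mu>] l \<mu> ratio_power_mono [of 1 \<mu> l]
    by (auto simp: power_divide)
qed

end
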